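(* If $f\in\mathcal{C}$ is a convex function with logarithmic coefficients $\gamma_1,\gamma_2,\gamma_3,\dots$, then $$|\gamma_1^2-\gamma_2^2|\le\frac5{16}\quad\text{and}\quad|\gamma_2^2-\gamma_3^2|\le\frac{13}{144}.$$
   Context: $\mathbb{D}=\{z\in\mathbb{C}:|z|<1\}$. $\mathcal{S}$ is the class of univalent analytic functions $f$ on $\mathbb{D}$ of the form $f(z)=z+\sum_{n\ge2}a_nz^n$. The logarithmic coefficients $\gamma_n=\gamma_n(f)$ of $f\in\mathcal{S}$ are defined by $\log\frac{f(z)}{z}=2\sum_{n=1}^\infty\gamma_nz^n$, $z\in\mathbb{D}$, where $\log 1=0$. $\mathcal{C}$ is the class of $f\in\mathcal{S}$ such that $f(\mathbb{D})$ is convex; equivalently, $\operatorname{Re}(1+zf''(z)/f'(z))>0$ for $z\in\mathbb{D}$. *)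

theory Defs
  imports "HOL-Complex_Analysis.Complex_Analysis"
begin

definition class_S :: "(complex \<Rightarrow> complex) set" where
  "class_S = {f. f holomorphic_on ball 0 1 \<and> inj_on f (ball 0 1) \<and>
     (\<exists>a :: nat \<Rightarrow> complex. \<forall>z\<in>ball 0 1. (\<lambda>n. a (n + 2) * z ^ (n + 2)) sums (f z - z))}"

definition class_C :: "(complex \<Rightarrow> complex) set" where
  "class_C = {f \<in> class_S. convex (f ` ball 0 1)}"

text \<open>
  \<open>log_coeffs f \<gamma>\<close>: the values \<open>\<gamma> 1, \<gamma> 2, \<dots>\<close> are the logarithmic coefficients of \<open>f\<close>.
  The function \<open>g\<close> is the branch of \<open>log (f z / z)\<close> on the unit disc that vanishes at 0,
  where \<open>f z / z\<close> has the value 1. The principal branch \<^const>\<open>Ln\<close> would be wrong for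
  general members of \<^const>\<open>class_S\<close>, since \<open>f z / z\<close> may cross the negative real axis.
  The value \<open>\<gamma> 0\<close> is unconstrained.
\<close>
definition log_coeffs :: "(complex \<Rightarrow> complex) \<Rightarrow> (nat \<Rightarrow> complex) \<Rightarrow> bool" where
  "log_coeffs f \<gamma> \<longleftrightarrow>
     (\<exists>g. g holomorphic_on ball 0 1 \<and> g 0 = 0 \<and>
          (\<forall>z\<in>ball 0 1 - {0}. exp (g z) = f z / z) \<and>
          (\<forall>z\<in>ball 0 1. (\<lambda>n. 2 * (\<gamma> (n + 1) * z ^ (n + 1))) sums g z))"

lemma sums_imp_has_fps_expansion:
  fixes b :: "nat \<Rightarrow> complex"
  assumes "\<And>z. z \<in> ball 0 1 \<Longrightarrow> (\<lambda>n. b n * z ^ n) sums f z"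
  shows "f has_fps_expansion Abs_fps b"
proof -
  have "summable (\<lambda>n. b n * (1 / 2) ^ n)"
    using assms[of "1 / 2"] by (auto simp: sums_iff)
  hence "conv_radius b \<ge> norm (1 / 2 :: complex)"
    by (rule conv_radius_geI)
  hence "fps_conv_radius (Abs_fps b) > 0"
    using less_le_trans[of 0 "ereal (norm (1 / 2 :: complex))" "conv_radius b"]
    by (simp add: fps_conv_radius_def)
  moreover have "eventually (\<lambda>z. eval_fps (Abs_fps b) z = f z) (nhds 0)"
    by (rule eventually_mono[OF eventually_nhds_in_open[of "ball 0 1"]])
       (use assms in \<open>auto simp: eval_fps_def sums_iff\<close>)
  ultimately show ?thesis
    by (simp add: has_fps_expansion_def)
qed

lemma class_S_iff:
  "f \<in> class_S \<longleftrightarrow>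
     f holomorphic_on ball 0 1 \<and> inj_on f (ball 0 1) \<and> f 0 = 0 \<and> deriv f 0 = 1"
proof -
  have "(\<exists>a :: nat \<Rightarrow> complex. \<forall>z\<in>ball 0 1. (\<lambda>n. a (n + 2) * z ^ (n + 2)) sums (f z - z))
        \<longleftrightarrow> f 0 = 0 \<and> deriv f 0 = 1" (is "?L \<longleftrightarrow> ?R")
    if hol: "f holomorphic_on ball 0 1"
  proof
    assume ?L
    then obtain a where a: "\<And>z. z \<in> ball 0 1 \<Longrightarrow> (\<lambda>n. a (n + 2) * z ^ (n + 2)) sums (f z - z)"
      by blast
    define b where "b = (\<lambda>n::nat. if n = 0 then 0 else if n = 1 then 1 else a n)"
    have b: "(\<lambda>n. b n * z ^ n) sums f z" if "z \<in> ball 0 1" for z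
    proof -
      have "(\<lambda>n. b (n + 2) * z ^ (n + 2)) sums (f z - (\<Sum>i<2. b i * z ^ i))"
        using a[OF that] by (simp add: b_def lessThan_nat_numeral)
      thus ?thesis using sums_iff_shift'[of "\<lambda>n. b n * z ^ n" 2 "f z"] by simp
    qed
    have "f 0 = 0" using sums_unique2[OF b[of 0] powser_sums_zero[of b]]
      by (simp add: b_def)
    moreover have "deriv f 0 = 1"
    proof -
      have fps: "f has_fps_expansion Abs_fps b"
        using b by (intro sums_imp_has_fps_expansion) simp
      show ?thesis using fps_nth_fps_expansion[OF fps, of 1] by (simp add: b_def)
    qed
    ultimately show ?R by simp
  next
    assume R: ?R
    define a where "a = (\<lambda>n. (deriv ^^ n) f 0 / fact n)"
    have "(\<lambda>n. a (n + 2) * z ^ (n + 2)) sums (f z - z)" if "z \<in> ball 0 1" for z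
    proof -
      have "(\<lambda>n. a n * z ^ n) sums f z"
        using holomorphic_power_series[OF hol that] by (simp add: a_def)
      hence "(\<lambda>n. a (n + 2) * z ^ (n + 2)) sums (f z - (\<Sum>i<2. a i * z ^ i))"
        using sums_iff_shift'[of "\<lambda>n. a n * z ^ n" 2 "f z"] by simp
      thus ?thesis using R by (simp add: a_def lessThan_nat_numeral)
    qed
    thus ?L by blast
  qed
  thus ?thesis unfolding class_S_def by blast
qed

lemma log_coeffs_exists:
  assumes "f \<in> class_S"
  shows "\<exists>\<gamma>. log_coeffs f \<gamma>"
proof -
  have hol: "f holomorphic_on ball 0 1" and inj: "inj_on f (ball 0 1)"
    and f0: "f 0 = 0" and f1: "deriv f 0 = 1"
    using assms by (auto simp: class_S_iff)
  define h where "h = (\<lambda>z. if z = 0 then deriv f 0 else f z / z)"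
  have "h holomorphic_on ball 0 1"
    by (rule pole_theorem_open_0[OF hol, of 0]) (auto simp: h_def f0)
  moreover have "h z \<noteq> 0" if "z \<in> ball 0 1" for z
    using that f0 f1 inj_onD[OF inj, of z 0] by (auto simp: h_def)
  ultimately obtain g where g: "g holomorphic_on ball 0 1" "\<And>z. z \<in> ball 0 1 \<Longrightarrow> h z = exp (g z)"
    using contractible_imp_holomorphic_log[of h "ball 0 1"]
    by (metis convex_ball convex_imp_contractible)
  define G where "G = (\<lambda>z. g z - g 0)"
  have "exp (g 0) = 1" using g(2)[of 0] f1 by (simp add: h_def)
  hence expG: "exp (G z) = f z / z" if "z \<in> ball 0 1 - {0}" for z
    using g(2)[of z] that by (simp add: G_def exp_diff h_def)
  have G: "G holomorphic_on ball 0 1" "G 0 = 0"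
    using g(1) by (auto simp: G_def intro: holomorphic_intros)
  define \<gamma> where "\<gamma> = (\<lambda>n. (deriv ^^ n) G 0 / fact n / 2)"
  have "(\<lambda>n. 2 * (\<gamma> (n + 1) * z ^ (n + 1))) sums G z" if "z \<in> ball 0 1" for z
  proof -
    have "(\<lambda>n. 2 * (\<gamma> n * z ^ n)) sums G z"
      using holomorphic_power_series[OF G(1) that] by (simp add: \<gamma>_def)
    thus ?thesis
      using G(2) sums_iff_shift'[of "\<lambda>n. 2 * (\<gamma> n * z ^ n)" 1 "G z"] by (simp add: \<gamma>_def)
  qed
  thus ?thesis unfolding log_coeffs_def using G expG by blast
qed

lemma log_coeffs_unique:
  assumes "log_coeffs f \<gamma>" "log_coeffs f \<delta>" "n \<ge> 1"
  shows "\<gamma> n = \<delta> n"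
proof -
  obtain g where g: "g holomorphic_on ball 0 1" "g 0 = 0"
      "\<And>z. z \<in> ball 0 1 - {0} \<Longrightarrow> exp (g z) = f z / z"
      "\<And>z. z \<in> ball 0 1 \<Longrightarrow> (\<lambda>n. 2 * (\<gamma> (n + 1) * z ^ (n + 1))) sums g z"
    using assms(1) unfolding log_coeffs_def by blast
  obtain h where h: "h holomorphic_on ball 0 1" "h 0 = 0"
      "\<And>z. z \<in> ball 0 1 - {0} \<Longrightarrow> exp (h z) = f z / z"
      "\<And>z. z \<in> ball 0 1 \<Longrightarrow> (\<lambda>n. 2 * (\<delta> (n + 1) * z ^ (n + 1))) sums h z"
    using assms(2) unfolding log_coeffs_def by blast
  have fps: "k has_fps_expansion Abs_fps (\<lambda>n. if n = 0 then 0 else 2 * \<epsilon> n)"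
    if k: "\<And>z. z \<in> ball 0 1 \<Longrightarrow> (\<lambda>n. 2 * (\<epsilon> (n + 1) * z ^ (n + 1))) sums k z" for k :: "complex \<Rightarrow> complex" and \<epsilon>
  proof -
    have "(\<lambda>n. (if n = 0 then 0 else 2 * \<epsilon> n) * z ^ n) sums k z" if "z \<in> ball 0 1" for z
      using k[OF that] sums_iff_shift'[of "\<lambda>n. (if n = 0 then 0 else 2 * \<epsilon> n) * z ^ n" 1 "k z"]
      by (simp add: mult.assoc)
    thus ?thesis
      by (rule sums_imp_has_fps_expansion)
  qed
  have eq: "exp (g z) = exp (h z)" if "z \<in> ball 0 1" for z
    using g(2) h(2) g(3)[of z] h(3)[of z] that by (cases "z = 0") auto
  have "\<exists>c. \<forall>z\<in>ball 0 1. g z - h z = c"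
  proof (rule has_field_derivative_zero_constant)
    fix z :: complex assume z: "z \<in> ball 0 1"
    have dg: "(g has_field_derivative deriv g z) (at z)"
      and dh: "(h has_field_derivative deriv h z) (at z)"
      using holomorphic_derivI[OF g(1) _ z] holomorphic_derivI[OF h(1) _ z] by auto
    have "((\<lambda>z. exp (g z)) has_field_derivative exp (h z) * deriv h z) (at z)"
      by (rule has_field_derivative_transform_within_open[OF DERIV_fun_exp[OF dh] open_ball z])
         (simp add: eq)
    with DERIV_fun_exp[OF dg] have "exp (g z) * deriv g z = exp (h z) * deriv h z"
      by (rule DERIV_unique)
    hence "deriv g z = deriv h z" using eq[OF z] by simp
    thus "((\<lambda>z. g z - h z) has_field_derivative 0) (at z within ball 0 1)"
      using DERIV_subset[OF DERIV_diff[OF dg dh]] by simp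
  qed simp
  then obtain c where c: "\<And>z. z \<in> ball 0 1 \<Longrightarrow> g z - h z = c" by blast
  have gh: "g z = h z" if "z \<in> ball 0 1" for z
    using c[of 0] c[OF that] g(2) h(2) by simp
  have "(\<lambda>n. 2 * (\<delta> (n + 1) * z ^ (n + 1))) sums g z" if "z \<in> ball 0 1" for z
    using h(4)[OF that] gh[OF that] by simp
  from fps[OF this] fps[OF g(4)]
  have "Abs_fps (\<lambda>n. if n = 0 then 0 else 2 * \<delta> n) = Abs_fps (\<lambda>n. if n = 0 then 0 else 2 * \<gamma> n)"
    by (intro fps_expansion_unique_complex) simp_all
  from arg_cong[OF this, of "\<lambda>F. fps_nth F n"] assms(3) show ?thesis by simp
qed

end

(*
  Let f be convex and univalent with f 0 = 0. Applying the Schwarz lemma to the self-maps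
  w \<mapsto> f^-1 ((1 - t) f(w) + t f(b w)), for a fixed b with |b| \<le> 1, and letting t tend to 0 gives
  Re q(b) \<ge> 0 for q(b) = (f(z) - f(b z)) / (z f'(z)). Since q(1) = 0 and q'(1) = -1, the function
  1/q(b) - 1/(1 - b) extends holomorphically across b = 1, and its real part is at least -1/2 on
  the unit circle because Re (1/(1 - b)) = 1/2 there. At b = 0 this reads Re (z f'(z) / f(z)) \<ge> 1/2.
  As 2 z f'(z) / f(z) - 1 = 1 + \<Sum> 4 n \<gamma>_n z^n, the Caratheodory coefficient bound gives
  |\<gamma>_n| \<le> 1/(2 n), and both inequalities follow from the triangle inequality.
*)
theory Submission
  imports Defs
begin

section \<open>Taylor coefficients and the Caratheodory bound\<close>

text \<open>This is Cauchy's formula for the \<open>n\<close>-th derivative, parametrised on the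
  circle of radius \<open>r\<close> and multiplied by \<open>r ^ n / i\<close>. The case
  \<open>n = 0\<close> is the mean value property.\<close>

lemma holomorphic_circle_fourier:
  assumes h: "h holomorphic_on ball 0 1" and r: "0 < r" "r < 1"
  shows "((\<lambda>t. h (of_real r * cis t) * cis (- (real n * t))) has_integral
           of_real (2 * pi * r ^ n) * ((deriv ^^ n) h 0 / fact n)) {0..2 * pi}"
proof -
  have hr: "h holomorphic_on cball 0 r"
    by (rule holomorphic_on_subset[OF h]) (use r in auto)
  have "((\<lambda>u. h u / (u - 0) ^ Suc n) has_contour_integral
           (2 * pi * \<i> / fact n * (deriv ^^ n) h 0)) (circlepath 0 r)"
    by (rule Cauchy_has_contour_integral_higher_derivative_circlepath)
       (use r hr in \<open>auto intro: holomorphic_on_imp_continuous_on holomorphic_on_subset\<close>)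
  hence "((\<lambda>t. h (0 + r * cis t) / (0 + r * cis t - 0) ^ Suc n * r * \<i> * cis t) has_integral
           (2 * pi * \<i> / fact n * (deriv ^^ n) h 0)) {0..2 * pi}"
    unfolding circlepath_def by (subst (asm) has_contour_integral_part_circlepath_iff) auto
  from has_integral_mult_right[OF this, of "of_real r ^ n / \<i>"]
  have "((\<lambda>t. of_real r ^ n / \<i> * (h (0 + r * cis t) / (0 + r * cis t - 0) ^ Suc n * r * \<i> * cis t))
          has_integral of_real r ^ n / \<i> * (2 * pi * \<i> / fact n * (deriv ^^ n) h 0)) {0..2 * pi}" .
  moreover have "of_real r ^ n / \<i> * (h (0 + r * cis t) / (0 + r * cis t - 0) ^ Suc n * r * \<i> * cis t)
      = h (of_real r * cis t) * cis (- (real n * t))" for t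
  proof -
    have "cis (- (real n * t)) = 1 / cis t ^ n"
      by (simp only: Complex.DeMoivre inverse_eq_divide[symmetric] cis_inverse)
    thus ?thesis using r by (simp add: power_mult_distrib mult_ac)
  qed
  ultimately show ?thesis
    by (simp add: mult_ac)
qed

text \<open>The conjugate of \<open>q\<close> contributes nothing to the Fourier coefficient of
  order \<open>n\<close>, so \<open>q\<close> may be replaced there by \<open>2 Re q\<close>. This
  is nonnegative, so the coefficient is at most its integral, which is known from
  \<open>q 0 = 1\<close>. Finally \<open>r\<close> tends to 1.\<close>

lemma caratheodory_coeff_bound:
  assumes q: "q holomorphic_on ball 0 1" and q0: "q 0 = 1"
    and pos: "\<And>z. z \<in> ball 0 1 \<Longrightarrow> 0 \<le> Re (q z)" and n: "n \<ge> 1"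
  shows "norm ((deriv ^^ n) q 0 / fact n) \<le> 2"
proof -
  define c where "c = (deriv ^^ n) q 0 / fact n"
  have bound: "r ^ n * norm c \<le> 2" if r: "0 < r" "r < 1" for r
  proof -
    let ?w = "\<lambda>t. of_real r * cis t"
    have I1: "((\<lambda>t. q (?w t) * cis (- (real n * t))) has_integral of_real (2 * pi * r ^ n) * c) {0..2 * pi}"
      unfolding c_def by (rule holomorphic_circle_fourier[OF q r])
    have I0: "((\<lambda>t. q (?w t)) has_integral of_real (2 * pi)) {0..2 * pi}"
      using holomorphic_circle_fourier[OF q r, of 0] by (simp add: q0)
    \<comment> \<open>This function vanishes at 0, so its circle mean is 0; conjugation then gives
      \<open>I2\<close>, the vanishing coefficient of the conjugate of \<open>q\<close>.\<close>
    have "(\<lambda>z. z ^ n * q z) holomorphic_on ball 0 1"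
      using q by (intro holomorphic_intros)
    from holomorphic_circle_fourier[OF this r, of 0] n
    have "((\<lambda>t. ?w t ^ n * q (?w t)) has_integral 0) {0..2 * pi}"
      by (simp add: power_0_left)
    from has_integral_mult_right[OF this, of "1 / of_real r ^ n"]
    have "((\<lambda>t. cis (real n * t) * q (?w t)) has_integral 0) {0..2 * pi}"
      using r by (simp add: power_mult_distrib Complex.DeMoivre)
    hence "(cnj \<circ> (\<lambda>t. cis (real n * t) * q (?w t)) has_integral cnj 0) {0..2 * pi}"
      by (simp only: has_integral_cnj)
    hence I2: "((\<lambda>t. cis (- (real n * t)) * cnj (q (?w t))) has_integral 0) {0..2 * pi}"
      by (simp add: o_def cis_cnj)
    have J: "((\<lambda>t. 2 * Re (q (?w t)) * cis (- (real n * t))) has_integral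
               of_real (2 * pi * r ^ n) * c) {0..2 * pi}"
    proof -
      have "2 * Re (q (?w t)) * cis (- (real n * t)) =
          q (?w t) * cis (- (real n * t)) + cis (- (real n * t)) * cnj (q (?w t))" for t
        by (simp add: complex_eq_iff algebra_simps)
      thus ?thesis
        using has_integral_add[OF I1 I2] by (simp only: add_0_right)
    qed
    have K: "((\<lambda>t. 2 * Re (q (?w t))) has_integral 2 * (2 * pi)) {0..2 * pi}"
      using has_integral_mult_right[OF has_integral_Re[OF I0], of 2] by simp
    have "norm (integral {0..2 * pi} (\<lambda>t. 2 * Re (q (?w t)) * cis (- (real n * t))))
            \<le> integral {0..2 * pi} (\<lambda>t. 2 * Re (q (?w t)))"
    proof (rule Henstock_Kurzweil_Integration.integral_norm_bound_integral)
      fix t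
      have "0 \<le> Re (q (?w t))" by (rule pos) (use r in \<open>simp add: norm_mult\<close>)
      thus "norm (complex_of_real (2 * Re (q (?w t))) * cis (- (real n * t))) \<le> 2 * Re (q (?w t))"
        by (simp add: norm_mult)
    qed (use J K in \<open>auto simp: has_integral_iff\<close>)
    hence "norm (of_real (2 * pi * r ^ n) * c) \<le> 2 * (2 * pi)"
      using J K by (simp add: has_integral_iff)
    thus ?thesis using r by (simp add: norm_mult norm_power mult.commute)
  qed
  have "((\<lambda>r. r ^ n * norm c) \<longlongrightarrow> 1 ^ n * norm c) (at_left (1::real))"
    by (intro tendsto_intros)
  moreover have "eventually (\<lambda>r. r ^ n * norm c \<le> 2) (at_left (1::real))"
    using eventually_at_left_real[of 0 1] by (rule eventually_mono) (auto intro: bound)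
  ultimately have "1 ^ n * norm c \<le> 2"
    by (rule tendsto_upperbound) simp
  thus ?thesis by (simp add: c_def)
qed

section \<open>Convex functions and starlikeness of order 1/2\<close>

text \<open>The Schwarz bound for \<open>F (L t z)\<close> is an equality at \<open>t = 0\<close>,
  so moving along the segment from \<open>f z\<close> to \<open>f (b * z)\<close> cannot increase
  \<open>Re (F (L t z) / z)\<close> to first order.\<close>

lemma convex_univalent_secant:
  assumes hol: "f holomorphic_on ball 0 1" and inj: "inj_on f (ball 0 1)"
    and conv: "convex (f ` ball 0 1)"
    and z: "z \<in> ball 0 1" "z \<noteq> 0" and b: "norm b \<le> 1"
  shows "0 \<le> Re ((f z - f (b * z)) / (z * deriv f z))"
proof -
  obtain F where F: "F holomorphic_on (f ` ball 0 1)"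
    "\<And>w. w \<in> ball 0 1 \<Longrightarrow> deriv f w * deriv F (f w) = 1"
    "\<And>w. w \<in> ball 0 1 \<Longrightarrow> F (f w) = w"
    using holomorphic_has_inverse[OF hol open_ball inj] by blast
  have opn: "open (f ` ball 0 1)"
    by (rule open_mapping_thm3[OF hol open_ball inj])
  have bw: "b * w \<in> ball 0 1" if "w \<in> ball 0 1" for w
    using that b mult_mono[of "norm b" 1 "norm w" "norm w"] by (auto simp: norm_mult)
  define L where "L = (\<lambda>t w. f w + of_real t * (f (b * w) - f w))"
  have L: "L t w \<in> f ` ball 0 1" if "w \<in> ball 0 1" "0 \<le> t" "t \<le> 1" for t w
  proof -
    have "(1 - t) *\<^sub>R f w + t *\<^sub>R f (b * w) \<in> f ` ball 0 1"
      using that bw[OF that(1)] by (intro convexD_alt[OF conv]) auto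
    thus ?thesis by (simp add: L_def scaleR_conv_of_real algebra_simps)
  qed
  have schwarz: "norm (F (L t z)) \<le> norm z" if t: "0 \<le> t" "t \<le> 1" for t
  proof (rule Schwarz_Lemma(1)[where f = "\<lambda>w. F (L t w)"])
    have "(\<lambda>w. f (b * w)) holomorphic_on ball 0 1"
      by (rule holomorphic_on_compose_gen[OF _ hol, of "\<lambda>w. b * w", unfolded o_def])
         (use bw in \<open>auto intro!: holomorphic_intros\<close>)
    hence "L t holomorphic_on ball 0 1"
      unfolding L_def using hol by (intro holomorphic_intros)
    thus "(\<lambda>w. F (L t w)) holomorphic_on ball 0 1"
      by (rule holomorphic_on_compose_gen[OF _ F(1), unfolded o_def]) (use L t in auto)
    \<comment> \<open>At \<open>w = 0\<close> the segment degenerates to the point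
      \<open>f 0\<close>.\<close>
    show "F (L t 0) = 0" by (simp add: L_def F)
    show "norm (F (L t w)) < 1" if "norm w < 1" for w
      using L[of w t] that t F(3) by auto
  qed (use z in auto)
  \<comment> \<open>Division by \<open>z\<close> normalises to \<open>u 0 = 1\<close>, the largest
    value that Schwarz permits. The slope \<open>D\<close> at 0 is minus the quotient in the
    claim.\<close>
  define u where "u = (\<lambda>t::real. Re (F (L t z) / z))"
  define D where "D = (f (b * z) - f z) / (z * deriv f z)"
  have dF: "(F has_field_derivative deriv F (f z)) (at (L 0 z))"
    using holomorphic_derivI[OF F(1) opn, of "f z"] z by (simp add: L_def)
  have dL: "((\<lambda>t. L t z) has_vector_derivative (f (b * z) - f z)) (at 0)"
    unfolding L_def by (auto intro!: derivative_eq_intros simp: has_vector_derivative_def scaleR_conv_of_real)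
  have "((\<lambda>t. F (L t z)) has_vector_derivative (f (b * z) - f z) * deriv F (f z)) (at 0)"
    using field_vector_diff_chain_at[OF dL dF] by (simp add: o_def)
  hence "((\<lambda>t. F (L t z) / z) has_vector_derivative (f (b * z) - f z) * deriv F (f z) / z) (at 0)"
    by (rule has_vector_derivative_divide)
  moreover have "deriv F (f z) = 1 / deriv f z"
    using F(2)[OF z(1)] by (metis mult_zero_left nonzero_eq_divide_eq mult.commute zero_neq_one)
  ultimately have "((\<lambda>t. F (L t z) / z) has_vector_derivative D) (at 0)"
    by (simp add: D_def field_simps)
  hence du: "(u has_real_derivative Re D) (at 0)"
    unfolding u_def has_real_derivative_iff_has_vector_derivative
    by (rule bounded_linear.has_vector_derivative[OF bounded_linear_Re])
  have "Re D \<le> 0"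
  proof (rule ccontr)
    assume "\<not> Re D \<le> 0"
    then obtain d where d: "d > 0" "\<And>h. 0 < h \<Longrightarrow> h < d \<Longrightarrow> u 0 < u (0 + h)"
      using DERIV_pos_inc_right[OF du] by auto
    \<comment> \<open>The cap at 1 keeps \<open>h\<close> in the range where convexity keeps
      \<open>L h\<close> inside the image.\<close>
    define h where "h = min (d / 2) 1"
    have h: "0 < h" "h < d" "h \<le> 1" using d(1) by (auto simp: h_def)
    have "u h \<le> norm (F (L h z) / z)" unfolding u_def by (rule complex_Re_le_cmod)
    also have "\<dots> \<le> 1" using schwarz[of h] h z by (simp add: norm_divide)
    also have "1 = u 0" using z F(3)[of z] by (simp add: u_def L_def)
    finally show False using d(2)[of h] h by simp
  qed
  thus ?thesis
    by (simp add: D_def minus_diff_eq[of "f (b * z)" "f z", symmetric] del: minus_diff_eq)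
qed

text \<open>On the unit circle \<open>|1 - b|^2 = 2 (1 - Re b)\<close>, twice the numerator of the
  real part.\<close>

lemma Re_geometric_sphere:
  assumes "norm b = 1" "b \<noteq> (1::complex)"
  shows "Re (1 / (1 - b)) = 1 / 2"
proof -
  have b: "(Re b)\<^sup>2 + (Im b)\<^sup>2 = 1"
    using assms(1) by (simp add: cmod_def)
  have "Re b \<noteq> 1" using b assms(2) by (auto simp: complex_eq_iff)
  moreover have "(1 - Re b)\<^sup>2 + (Im b)\<^sup>2 = 2 * (1 - Re b)"
    using b by (simp add: power2_eq_square algebra_simps)
  ultimately show ?thesis
    by (simp add: Re_divide)
qed

text \<open>Near 1 the function \<open>1 / q\<close> has the same simple pole as
  \<open>1 / (1 - b)\<close>, because \<open>q\<close> has derivative -1 there. The difference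
  \<open>R\<close> is therefore holomorphic on \<open>T\<close>, and the maximum principle carries
  the bound on its real part from the circle to 0.\<close>

lemma boundary_zero_Re_inverse:
  assumes T: "open T" "cball 0 1 \<subseteq> T" and q: "q holomorphic_on T"
    and nz: "\<And>b. b \<in> T - {1} \<Longrightarrow> q b \<noteq> 0"
    and q1: "q 1 = 0" "deriv q 1 = -1"
    and pos: "\<And>b. norm b = 1 \<Longrightarrow> 0 \<le> Re (q b)"
  shows "1 / 2 \<le> Re (1 / q 0)"
proof -
  \<comment> \<open>The value 1 at \<open>b = 1\<close> is the limit of the quotient, namely
    \<open>- deriv q 1\<close>; so \<open>s\<close> has no zero on \<open>T\<close>.\<close>
  define s where "s = (\<lambda>b. if b = 1 then 1 else q b / (1 - b))"
  have "(\<lambda>b. - q b) holomorphic_on T" using q by (intro holomorphic_intros)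
  moreover have "deriv (\<lambda>b. - q b) 1 = 1"
    using q1 holomorphic_on_imp_differentiable_at[OF q T(1), of 1] subsetD[OF T(2), of 1]
    by (subst deriv_minus) auto
  ultimately have s: "s holomorphic_on T"
    by (rule_tac pole_theorem_open_0[OF _ T(1), of "\<lambda>b. - q b" 1]) (auto simp: s_def q1 field_simps)
  have s0: "s b \<noteq> 0" if "b \<in> T" for b
    using nz[of b] that by (auto simp: s_def)
  \<comment> \<open>Since \<open>s 1 = 1\<close>, \<open>k\<close> vanishes at 1 and can be divided
    by \<open>b - 1\<close>, which yields \<open>R\<close>.\<close>
  define k where "k = (\<lambda>b. 1 / s b - 1)"
  have k: "k holomorphic_on T"
    unfolding k_def using s s0 by (intro holomorphic_intros) auto
  define R where "R = (\<lambda>b. if b = 1 then deriv k 1 else k b / (b - 1))"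
  have R: "R holomorphic_on T"
    by (rule pole_theorem_open_0[OF k T(1), of 1]) (auto simp: R_def k_def s_def)
  have R_eq: "R b = 1 / (1 - b) - 1 / q b" if "b \<in> T" "b \<noteq> 1" for b
    using that nz[of b] by (auto simp: R_def k_def s_def field_simps)
  \<comment> \<open>The bound on \<open>Re R\<close> is computed only off the point 1. As 1 is not
    isolated on the circle, continuity extends it to all of \<open>?S\<close>.\<close>
  let ?S = "sphere 0 1 :: complex set"
  have clo: "closure (?S - {1}) = ?S"
  proof -
    have "connected ?S" by (rule connected_sphere) simp
    moreover have "?S \<noteq> {x}" for x
    proof
      assume "?S = {x}"
      moreover have "(1::complex) \<in> ?S" "(-1::complex) \<in> ?S" by simp_all
      ultimately have "(1::complex) = -1" by (metis singletonD)
      thus False by simp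
    qed
    ultimately have "1 islimpt ?S"
      by (intro connected_imp_perfect) auto
    hence "1 \<in> closure (?S - {1})" by (simp only: islimpt_in_closure)
    moreover have "closure (?S - {1}) \<subseteq> ?S"
      by (rule closure_minimal) auto
    ultimately show ?thesis using closure_subset[of "?S - {1}"] by auto
  qed
  have contR: "continuous_on T R" using R by (rule holomorphic_on_imp_continuous_on)
  have sph: "Re (R b) \<le> 1 / 2" if "b \<in> ?S" for b
  proof (rule continuous_le_on_closure[of "?S - {1}" "\<lambda>b. Re (R b)"])
    show "continuous_on (closure (?S - {1})) (\<lambda>b. Re (R b))"
      unfolding clo
      by (intro continuous_intros continuous_on_subset[OF contR]) (use T(2) in auto)
    show "b \<in> closure (?S - {1})" using that clo by simp
    fix c assume c: "c \<in> ?S - {1}"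
    have "Re (R c) = 1 / 2 - Re (1 / q c)"
      using R_eq[of c] c subsetD[OF T(2), of c] Re_geometric_sphere[of c] by (auto simp: dist_norm)
    moreover have "0 \<le> Re (1 / q c)"
      using pos[of c] c by (simp add: Re_divide)
    ultimately show "Re (R c) \<le> 1 / 2" by simp
  qed
  have "Re (R 0) \<le> 1 / 2"
  proof (rule maximum_real_frontier[of R "ball 0 1"])
    show "R holomorphic_on interior (ball 0 1)"
      by (rule holomorphic_on_subset[OF R]) (use T(2) in auto)
    show "continuous_on (closure (ball 0 1)) R"
      by (rule continuous_on_subset[OF contR]) (use T(2) in auto)
  qed (use sph in auto)
  moreover have "R 0 = 1 - 1 / q 0" using R_eq[of 0] subsetD[OF T(2), of 0] by auto
  ultimately show ?thesis by simp
qed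

text \<open>For fixed \<open>z\<close> the secant quotient is holomorphic in \<open>b\<close> on the
  disc of radius \<open>1 / norm z > 1\<close>, hence across the unit circle. Injectivity of
  \<open>f\<close> leaves \<open>b = 1\<close> as its only zero, and \<open>1 / q 0\<close> is the
  quantity to be estimated.\<close>

lemma convex_univalent_starlike_half:
  assumes hol: "f holomorphic_on ball 0 1" and inj: "inj_on f (ball 0 1)"
    and conv: "convex (f ` ball 0 1)" and f0: "f 0 = 0"
    and z: "z \<in> ball 0 1" "z \<noteq> 0"
  shows "1 / 2 \<le> Re (z * deriv f z / f z)"
proof -
  define T where "T = ball (0::complex) (1 / norm z)"
  define q where "q = (\<lambda>b. (f z - f (b * z)) / (z * deriv f z))"
  have T: "b * z \<in> ball 0 1" if "b \<in> T" for b
    using that z by (simp add: T_def norm_mult field_simps)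
  have df: "deriv f z \<noteq> 0"
    by (rule holomorphic_injective_imp_regular[OF hol open_ball inj z(1)])
  have "(\<lambda>b. f (b * z)) holomorphic_on T"
    by (rule holomorphic_on_compose_gen[OF _ hol, of "\<lambda>b. b * z", unfolded o_def])
       (use T in \<open>auto intro!: holomorphic_intros\<close>)
  hence q: "q holomorphic_on T"
    unfolding q_def using z df by (intro holomorphic_intros) auto
  have "1 / 2 \<le> Re (1 / q 0)"
  proof (rule boundary_zero_Re_inverse[OF _ _ q])
    show "open T" by (simp add: T_def)
    show "cball 0 1 \<subseteq> T"
    proof
      fix b :: complex assume "b \<in> cball 0 1"
      moreover have "1 < 1 / norm z" using z by (simp add: field_simps)
      ultimately show "b \<in> T" by (simp add: T_def)
    qed
    show "q b \<noteq> 0" if b: "b \<in> T - {1}" for b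
    proof -
      have "f z \<noteq> f (b * z)"
        using inj_onD[OF inj, of z "b * z"] T[of b] b z by auto
      thus ?thesis using z df by (simp add: q_def)
    qed
    show "q 1 = 0" by (simp add: q_def)
    have fz: "(f has_field_derivative deriv f z) (at (1 * z))"
      using holomorphic_derivI[OF hol open_ball z(1)] by simp
    have "((\<lambda>b. f (b * z)) has_field_derivative deriv f z * z) (at 1)"
      by (rule DERIV_chain2[of f _ "\<lambda>b. b * z", OF fz]) (auto intro!: derivative_eq_intros)
    hence "(q has_field_derivative (0 - deriv f z * z) / (z * deriv f z)) (at 1)"
      unfolding q_def by (intro DERIV_cdivide DERIV_diff DERIV_const)
    thus "deriv q 1 = -1"
      using z df by (intro DERIV_imp_deriv) (simp add: field_simps)
    show "0 \<le> Re (q b)" if "norm b = 1" for b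
      unfolding q_def by (rule convex_univalent_secant[OF hol inj conv z]) (use that in simp)
  qed
  thus ?thesis by (simp add: q_def f0)
qed

section \<open>Logarithmic coefficients\<close>

lemma convex_log_coeff_bound:
  assumes "f \<in> class_C" and "log_coeffs f \<gamma>" and n: "n \<ge> 1"
  shows "norm (\<gamma> n) \<le> 1 / (2 * real n)"
proof -
  have hol: "f holomorphic_on ball 0 1" and inj: "inj_on f (ball 0 1)" and f0: "f 0 = 0"
    and conv: "convex (f ` ball 0 1)"
    using assms(1) by (auto simp: class_C_def class_S_iff)
  obtain g where g: "g holomorphic_on ball 0 1"
      "\<And>z. z \<in> ball 0 1 - {0} \<Longrightarrow> exp (g z) = f z / z"
      "\<And>z. z \<in> ball 0 1 \<Longrightarrow> (\<lambda>n. 2 * (\<gamma> (n + 1) * z ^ (n + 1))) sums g z"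
    using assms(2) unfolding log_coeffs_def by blast
  \<comment> \<open>The constant term is set to 0 explicitly because \<open>log_coeffs\<close> does
    not determine \<open>\<gamma> 0\<close>.\<close>
  define G where "G = Abs_fps (\<lambda>n. if n = 0 then 0 else 2 * \<gamma> n)"
  have G: "g has_fps_expansion G"
    unfolding G_def
  proof (rule sums_imp_has_fps_expansion)
    fix z :: complex assume "z \<in> ball 0 1"
    from g(3)[OF this] show "(\<lambda>n. (if n = 0 then 0 else 2 * \<gamma> n) * z ^ n) sums g z"
      using sums_iff_shift'[of "\<lambda>n. (if n = 0 then 0 else 2 * \<gamma> n) * z ^ n" 1 "g z"]
      by (simp add: mult.assoc)
  qed
  \<comment> \<open>Written through \<open>g\<close>, this is holomorphic at 0 with value 1, where
    \<open>z * deriv f z / f z\<close> would take the default value 0 of division by zero.\<close>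
  define q where "q = (\<lambda>z. 1 + 2 * (z * deriv g z))"
  have qhol: "q holomorphic_on ball 0 1"
    unfolding q_def using g(1) by (intro holomorphic_intros) auto
  have q_eq: "q z = 2 * (z * deriv f z / f z) - 1" if z: "z \<in> ball 0 1" "z \<noteq> 0" for z
  proof -
    \<comment> \<open>Logarithmic differentiation of \<open>f w = w * exp (g w)\<close>, an identity
      taken from the punctured disc.\<close>
    have "((\<lambda>w. w * exp (g w)) has_field_derivative exp (g z) + z * (exp (g z) * deriv g z)) (at z)"
      using holomorphic_derivI[OF g(1) open_ball z(1)]
      by (auto intro!: derivative_eq_intros simp: algebra_simps)
    hence "(f has_field_derivative exp (g z) + z * (exp (g z) * deriv g z)) (at z)"
      by (rule has_field_derivative_transform_within_open[of _ _ _ "ball 0 1 - {0}"])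
         (use z g(2) in auto)
    hence "deriv f z = exp (g z) * (1 + z * deriv g z)"
      by (simp add: DERIV_imp_deriv algebra_simps)
    moreover have "f z = z * exp (g z)" using g(2)[of z] z by simp
    ultimately show ?thesis using z by (simp add: q_def)
  qed
  have pos: "0 \<le> Re (q z)" if z: "z \<in> ball 0 1" for z
  proof (cases "z = 0")
    case False
    thus ?thesis
      using convex_univalent_starlike_half[OF hol inj conv f0 z False]
      unfolding q_eq[OF z False] by (simp del: times_divide_eq_right)
  qed (simp add: q_def)
  have "norm ((deriv ^^ n) q 0 / fact n) \<le> 2"
    by (rule caratheodory_coeff_bound[OF qhol _ pos n]) (simp add: q_def)
  moreover have "q has_fps_expansion 1 + fps_const 2 * (fps_X * fps_deriv G)"
    unfolding q_def by (intro fps_expansion_intros G)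
  hence "(deriv ^^ n) q 0 / fact n = fps_nth (1 + fps_const 2 * (fps_X * fps_deriv G)) n"
    using fps_nth_fps_expansion by metis
  hence "(deriv ^^ n) q 0 / fact n = 4 * of_nat n * \<gamma> n"
    using n by (simp add: G_def)
  ultimately show ?thesis
    using n by (simp add: norm_mult field_simps)
qed

theorem corollary2p10:
  fixes f :: "complex \<Rightarrow> complex" and \<gamma> :: "nat \<Rightarrow> complex"
  assumes "f \<in> class_C" and "log_coeffs f \<gamma>"
  shows "norm ((\<gamma> 1)\<^sup>2 - (\<gamma> 2)\<^sup>2) \<le> 5 / 16 \<and> norm ((\<gamma> 2)\<^sup>2 - (\<gamma> 3)\<^sup>2) \<le> 13 / 144"
proof -
  have sq: "norm ((\<gamma> n)\<^sup>2) \<le> (1 / (2 * real n))\<^sup>2" if "n \<ge> 1" for n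
    unfolding norm_power by (intro power_mono convex_log_coeff_bound[OF assms that]) simp
  \<comment> \<open>The two constants are the sums 1/4 + 1/16 = 5/16 and 1/16 + 1/36 =
    13/144.\<close>
  have "norm ((\<gamma> 1)\<^sup>2) \<le> 1 / 4" "norm ((\<gamma> 2)\<^sup>2) \<le> 1 / 16" "norm ((\<gamma> 3)\<^sup>2) \<le> 1 / 36"
    using sq[of 1] sq[of 2] sq[of 3] by (simp_all add: power2_eq_square)
  thus ?thesis
    using norm_triangle_ineq4[of "(\<gamma> 1)\<^sup>2" "(\<gamma> 2)\<^sup>2"] norm_triangle_ineq4[of "(\<gamma> 2)\<^sup>2" "(\<gamma> 3)\<^sup>2"]
    by linarith
qed

end
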